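(* (1) Let $n,k$ be integers with $n\geq 2(k-1)$ and $k\geq 4$. Then $$\operatorname{gr}_k(K_{1,3}:P_n)=\begin{cases} n, & \text{if } 2(k-1)\leq n\leq 4(k-2)+1,\\ \left\lceil\frac{3n-3}{2}\right\rceil, & \text{if } n>4(k-2)+1.\end{cases}$$ (2) If $k=3$ and $n\geq 4$ is an integer, then $$\operatorname{gr}_k(K_{1,3}:P_n)=\begin{cases} \frac{3n}{2}-1, & \text{if } n \text{ is even},\\ \frac{3n-1}{2}, & \text{if } n \text{ is odd}.\end{cases}$$
   Context: $P_n$ denotes the path on $n$ vertices and $K_{1,3}$ the star with three edges. For graphs $G,H$ and a positive integer $k$, the Gallai-Ramsey number $\operatorname{gr}_k(G:H)$ is the minimum integer $N$ such that for every $n'\geq N$, every exact $k$-edge-coloring of the complete graph $K_{n'}$ (an edge-coloring in which exactly $k$ colors are used) contains either a rainbow copy of $G$ (a copy all of whose edges have pairwise distinct colors) or a monochromatic copy of $H$ (a copy all of whose edges have the same color). Copies are subgraphs, not necessarily induced; edge-colorings are not required to be proper.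
   Formalization: For n = 2(k-1), k ≥ 4, every integer N has the defining property (every exact k-coloring of a smaller complete graph has a rainbow K_{1,3}), so no minimum exists; the formal version sets the number to |V(P_n)| = n by convention whenever every integer has the property. *)

theory Defs
  imports Complex_Main
begin

(* Vertex set and edge set; an edge is a two-element set of vertices. *)
type_synonym 'a graph = "'a set \<times> 'a set set"

abbreviation verts :: "'a graph \<Rightarrow> 'a set" where
  "verts G \<equiv> fst G"

abbreviation edges :: "'a graph \<Rightarrow> 'a set set" where
  "edges G \<equiv> snd G"

definition complete_graph :: "nat \<Rightarrow> nat graph" where
  "complete_graph m = ({..<m}, {e. e \<subseteq> {..<m} \<and> card e = 2})"

definition path_graph :: "nat \<Rightarrow> nat graph" where
  "path_graph n = ({..<n}, {{i, Suc i} | i. Suc i < n})"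

(* K_{1,r}, with centre 0. *)
definition star_graph :: "nat \<Rightarrow> nat graph" where
  "star_graph r = ({..r}, {{0, i} | i. 1 \<le> i \<and> i \<le> r})"

(* f embeds G as a (not necessarily induced) subgraph of K. *)
definition is_copy :: "('a \<Rightarrow> 'b) \<Rightarrow> 'a graph \<Rightarrow> 'b graph \<Rightarrow> bool" where
  "is_copy f G K \<longleftrightarrow>
     inj_on f (verts G) \<and> f ` verts G \<subseteq> verts K \<and> (\<forall>e\<in>edges G. f ` e \<in> edges K)"

(* Colours are natural numbers, and only the values of a colouring on edges matter. *)
definition exact_coloring :: "nat \<Rightarrow> 'b graph \<Rightarrow> ('b set \<Rightarrow> nat) \<Rightarrow> bool" where
  "exact_coloring k K c \<longleftrightarrow> finite (c ` edges K) \<and> card (c ` edges K) = k"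

definition has_rainbow_copy :: "'a graph \<Rightarrow> 'b graph \<Rightarrow> ('b set \<Rightarrow> nat) \<Rightarrow> bool" where
  "has_rainbow_copy G K c \<longleftrightarrow>
     (\<exists>f. is_copy f G K \<and> inj_on (\<lambda>e. c (f ` e)) (edges G))"

definition has_mono_copy :: "'a graph \<Rightarrow> 'b graph \<Rightarrow> ('b set \<Rightarrow> nat) \<Rightarrow> bool" where
  "has_mono_copy H K c \<longleftrightarrow>
     (\<exists>f. is_copy f H K \<and> (\<exists>col. \<forall>e\<in>edges H. c (f ` e) = col))"

definition gr_bound :: "nat \<Rightarrow> 'a graph \<Rightarrow> 'b graph \<Rightarrow> int \<Rightarrow> bool" where
  "gr_bound k G H N \<longleftrightarrow>
     (\<forall>m::nat. int m \<ge> N \<longrightarrow>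
        (\<forall>c. exact_coloring k (complete_graph m) c \<longrightarrow>
           has_rainbow_copy G (complete_graph m) c \<or> has_mono_copy H (complete_graph m) c))"

(* "gr_k(G:H) = N", as a relation, so that no value is asserted when no bound exists.
   The first disjunct is the definition: N is the least integer bound.
   The second one is a convention for the degenerate case in which every integer is a bound, i.e.
   no complete graph whatsoever has an exact k-colouring avoiding both a rainbow G and a
   monochromatic H. Then there is no minimum integer bound, and the number is taken to be
   |V(H)|, the least order of a complete graph that can contain H at all. The two
   disjuncts exclude each other. The degenerate case does occur: for G = K_{1,3}, H = P_n,
   k >= 4 and n = 2(k-1), since an exact k-colouring without rainbow K_{1,3} needs at least
   2(k-1) vertices and every such colouring then contains a monochromatic P_n. *)
definition gallai_ramsey_number :: "nat \<Rightarrow> 'a graph \<Rightarrow> 'b graph \<Rightarrow> int \<Rightarrow> bool" where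
  "gallai_ramsey_number k G H N \<longleftrightarrow>
     (gr_bound k G H N \<and> (\<forall>N'. gr_bound k G H N' \<longrightarrow> N \<le> N')) \<or>
     ((\<forall>N'. gr_bound k G H N') \<and> N = int (card (verts H)))"

end

theory Submission
  imports Defs
begin

text \<open>
  Without a rainbow \<open>K\<^sub>1\<^sub>,\<^sub>3\<close> every vertex sees at most two colours, and the colour sets of any two
  vertices intersect. Hence either all these sets share a colour \<open>\<alpha>\<close>, or \<open>k = 3\<close> and they are the
  three pairs of colours. In the first case the vertices fall into classes joined by \<open>\<alpha>\<close>, and each
  class uses at most one further colour; so the two-colour theorem of Gerencser and Gyarfas for paths
  applies, while for \<open>n \<le> 4(k - 2) + 1\<close> a longest path of colour \<open>\<alpha>\<close> is already long enough.
  In the second case let \<open>A\<close> be the largest of the three classes and \<open>b\<close>, \<open>c\<close> the sizes of the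
  others. The two colours inside \<open>A\<close> contain a path on \<open>n - 2b\<close> or \<open>n - 2c\<close> vertices of the
  respective colour, which is then extended by alternating between \<open>A\<close> and another class.

  The two-colour theorem is obtained by comparing a longest red path \<open>P\<close> with a set \<open>Y\<close> of vertices
  off \<open>P\<close>: no vertex of \<open>Y\<close> can be inserted into \<open>P\<close>, which forces so many blue edges between
  \<open>P\<close> and \<open>Y\<close> that a blue path alternates between \<open>P\<close> and all of \<open>Y\<close>.
\<close>

subsection \<open>The two-colour Ramsey theorem for paths\<close>

definition path_in :: "'a set \<Rightarrow> ('a \<Rightarrow> 'a \<Rightarrow> bool) \<Rightarrow> 'a list \<Rightarrow> bool" where
  "path_in V R xs \<longleftrightarrow> distinct xs \<and> set xs \<subseteq> V \<and> successively R xs"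

text \<open>Facts on consecutive vertices of a path are obtained below by changing the path at a
  split point, hence the hypothesis in terms of splittings.\<close>

lemma successively_if_split:
  assumes "\<And>as u v bs. xs = as @ u # v # bs \<Longrightarrow> Q u v"
  shows "successively Q xs"
  using assms
proof (induction xs rule: induct_list012)
  case (3 x y zs)
  have "Q x y" using 3(3)[of "[]"] by simp
  moreover have "successively Q (y # zs)"
    by (rule 3(2)) (metis 3(3) append_Cons)
  ultimately show ?case by simp
qed auto

text \<open>Between two entries in \<open>W\<close> there is one outside \<open>W\<close>, so
  \<open>W\<close> is ahead by at most one; each end outside \<open>W\<close> loses one more. The
  end terms are kept because the counts below need the exact parity.\<close>

lemma count_independent:
  assumes "successively (\<lambda>u v. \<not> (u \<in> W \<and> v \<in> W)) xs" "xs \<noteq> []"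
  shows "length (filter (\<lambda>x. x \<in> W) xs) + of_bool (hd xs \<notin> W) + of_bool (last xs \<notin> W)
           \<le> length (filter (\<lambda>x. x \<notin> W) xs) + 1"
  using assms
proof (induction xs rule: induct_list012)
  case (3 x y zs)
  then show ?case by (auto simp: of_bool_def split: if_splits)
qed auto

lemma card_independent:
  assumes "successively (\<lambda>u v. \<not> (u \<in> W \<and> v \<in> W)) xs" "xs \<noteq> []" "distinct xs"
  shows "card (set xs \<inter> W) + of_bool (hd xs \<notin> W) + of_bool (last xs \<notin> W)
           \<le> card (set xs - W) + 1"
proof -
  have "set xs \<inter> W = set (filter (\<lambda>x. x \<in> W) xs)" "set xs - W = set (filter (\<lambda>x. x \<notin> W) xs)"
    by auto
  then show ?thesis
    using count_independent[OF assms(1,2)] assms(3) by (metis distinct_card distinct_filter)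
qed

lemma path_in_take: "path_in V R xs \<Longrightarrow> path_in V R (take i xs)"
  unfolding path_in_def
  by (metis append_take_drop_id distinct_take order_trans set_take_subset successively_append_iff)

lemma path_in_length_le: "finite V \<Longrightarrow> path_in V R xs \<Longrightarrow> length xs \<le> card V"
  unfolding path_in_def by (metis card_mono distinct_card)

lemma ex_longest_path:
  assumes "finite V"
  obtains xs where "path_in V R xs" "\<And>ys. path_in V R ys \<Longrightarrow> length ys \<le> length xs"
proof -
  have "path_in V R []" by (simp add: path_in_def)
  moreover have "\<forall>ys. path_in V R ys \<longrightarrow> length ys < Suc (card V)"
    using path_in_length_le[OF assms] by (metis less_Suc_eq_le)
  ultimately show thesis
    using ex_has_greatest_nat[of "path_in V R" "[]" length] that by blast
qed

section \<open>Blue paths around a longest red path\<close>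

text \<open>\<open>R\<close> and \<open>B\<close> only have to cover all pairs. This lets the two
  colours exchange roles and lets \<open>B\<close> be a union of several colours.\<close>

locale longest_red =
  fixes V :: "'a set" and R B :: "'a \<Rightarrow> 'a \<Rightarrow> bool" and P :: "'a list"
  assumes finV: "finite V"
    and symR: "\<And>u v. R u v \<Longrightarrow> R v u" and symB: "\<And>u v. B u v \<Longrightarrow> B v u"
    and total: "\<And>u v. u \<in> V \<Longrightarrow> v \<in> V \<Longrightarrow> u \<noteq> v \<Longrightarrow> R u v \<or> B u v"
    and path: "path_in V R P"
    and longest: "\<And>ys. path_in V R ys \<Longrightarrow> length ys \<le> length P"
    and nonempty: "P \<noteq> []"
begin

lemma path': "distinct P" "set P \<subseteq> V" "successively R P"
  using path unfolding path_in_def by auto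

lemma hd_blue:
  assumes "y \<in> V - set P" shows "B (hd P) y"
proof (rule ccontr)
  assume "\<not> B (hd P) y"
  then have "R y (hd P)" using total[of "hd P" y] symR assms nonempty path' hd_in_set by blast
  then have "path_in V R (y # P)" using path' assms nonempty
    by (cases P) (auto simp: path_in_def)
  then show False using longest[of "y # P"] by simp
qed

lemma last_blue:
  assumes "y \<in> V - set P" shows "B (last P) y"
proof (rule ccontr)
  assume "\<not> B (last P) y"
  then have "R (last P) y" using total[of "last P" y] assms nonempty path' last_in_set by blast
  then have "path_in V R (P @ [y])" using path' assms nonempty
    by (auto simp: path_in_def successively_append_iff)
  then show False using longest[of "P @ [y]"] by simp
qed

lemma consecutive_blue:
  assumes "P = as @ u # v # bs" "y \<in> V - set P" shows "B u y \<or> B v y"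
proof (rule ccontr)
  assume c: "\<not> (B u y \<or> B v y)"
  have "u \<in> V" "v \<in> V" "u \<noteq> y" "v \<noteq> y" using assms path' by auto
  then have "R u y" "R y v" using c total[of u y] total[of v y] symR assms by auto
  then have "path_in V R (as @ u # y # v # bs)" using path' assms
    by (auto simp: path_in_def successively_append_iff)
  then show False using longest[of "as @ u # y # v # bs"] assms(1) by simp
qed

lemma ex_consecutive:
  assumes "card (set P - W) + 1 < card (set P \<inter> W)"
  obtains as u v bs where "P = as @ u # v # bs" "u \<in> W" "v \<in> W"
proof -
  have "\<not> successively (\<lambda>u v. \<not> (u \<in> W \<and> v \<in> W)) P"
    using card_independent[of W P] path' nonempty assms by auto
  then show thesis using successively_if_split[of P "\<lambda>u v. \<not> (u \<in> W \<and> v \<in> W)"] that by blast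
qed

text \<open>If \<open>y\<close> had no blue neighbour in \<open>W\<close>, no two consecutive
  vertices of \<open>P\<close> would lie in \<open>W\<close>, and neither would the ends of
  \<open>P\<close>, which are blue to \<open>y\<close>. Then \<open>W\<close> would be in the
  minority on \<open>P\<close>.\<close>

lemma ex_blue:
  assumes "card (set P - W) < card (set P \<inter> W) + 1" "y \<in> V - set P"
  obtains x where "x \<in> set P" "x \<in> W" "B x y"
proof (cases "\<exists>x \<in> set P \<inter> W. B x y")
  case False
  have "successively (\<lambda>u v. \<not> (u \<in> W \<and> v \<in> W)) P"
    by (rule successively_if_split) (use False consecutive_blue[OF _ assms(2)] in force)
  moreover have "hd P \<notin> W" "last P \<notin> W"
    using False hd_blue[OF assms(2)] last_blue[OF assms(2)] nonempty by auto
  ultimately show thesis using card_independent[of W P] path' nonempty assms by auto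
qed (use that in blast)

context
  fixes Y assumes Y: "Y \<subseteq> V - set P"
begin

definition alt where
  "alt x y \<longleftrightarrow> (x \<in> set P \<and> y \<in> Y \<or> x \<in> Y \<and> y \<in> set P) \<and> B x y"

text \<open>With both ends in \<open>Y\<close>, such a path has one vertex more in \<open>Y\<close>
  than on \<open>P\<close>, and a vertex of \<open>P\<close> can prolong it at either end or close
  it to a cycle.\<close>

definition alternating where
  "alternating Q \<longleftrightarrow> Q \<noteq> [] \<and> distinct Q \<and> successively alt Q \<and> hd Q \<in> Y \<and> last Q \<in> Y"

lemma disj: "x \<in> Y \<Longrightarrow> x \<notin> set P" using Y by auto

lemma alt_sym: "alt x y \<Longrightarrow> alt y x" using symB by (auto simp: alt_def)

lemma alternating_subset: 
  assumes "alternating Q" shows "set Q \<subseteq> set P \<union> Y"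
proof -
  have "successively alt Q \<Longrightarrow> hd Q \<in> Y \<Longrightarrow> set Q \<subseteq> set P \<union> Y" for Q
  proof (induction Q rule: induct_list012)
    case (3 x y zs)
    then show ?case by (cases zs) (auto simp: alt_def)
  qed auto
  then show ?thesis using assms by (auto simp: alternating_def)
qed

text \<open>Neither side contains two consecutive vertices of \<open>Q\<close>, so the counting
  lemma applied to both sides gives the two inequalities.\<close>

lemma alternating_card:
  assumes "alternating Q"
  shows "card (set Q \<inter> Y) = card (set P \<inter> set Q) + 1"
proof -
  have Q: "Q \<noteq> []" "distinct Q" "successively alt Q" "hd Q \<in> Y" "last Q \<in> Y"
    using assms by (auto simp: alternating_def)
  have "successively (\<lambda>u v. \<not> (u \<in> Y \<and> v \<in> Y)) Q"
    "successively (\<lambda>u v. \<not> (u \<in> set P \<and> v \<in> set P)) Q"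
    by (rule successively_mono[OF Q(3)], use disj in \<open>auto simp: alt_def\<close>)+
  moreover have "set Q - Y = set P \<inter> set Q" "set Q \<inter> set P = set P \<inter> set Q" "set Q - set P = set Q \<inter> Y"
    using alternating_subset[OF assms] disj by auto
  moreover have "hd Q \<notin> set P" "last Q \<notin> set P" using Q disj by auto
  ultimately show ?thesis
    using card_independent[of Y Q] card_independent[of "set P" Q] Q by simp
qed

lemma alternating_length: 
  assumes "alternating Q"
  shows "length Q = 2 * card (set P \<inter> set Q) + 1"
proof -
  have "set Q = (set Q \<inter> Y) \<union> (set P \<inter> set Q)" using alternating_subset[OF assms] by auto
  moreover have "(set Q \<inter> Y) \<inter> (set P \<inter> set Q) = {}" using disj by auto
  ultimately have "card (set Q) = card (set Q \<inter> Y) + card (set P \<inter> set Q)"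
    by (metis List.finite_set card_Un_disjoint finite_Int)
  then show ?thesis using alternating_card[OF assms] assms 
    by (simp add: alternating_def distinct_card)
qed

lemma card_P_minus: "card (set P - set Q) + card (set P \<inter> set Q) = length P"
  by (metis List.finite_set card_Diff_subset_Int card_mono distinct_card finite_Int inf_le1
      le_add_diff_inverse2 path'(1))

text \<open>Let \<open>Q\<close> be longest. A vertex of \<open>P\<close> off \<open>Q\<close> that
  is blue to \<open>y'\<close> cannot be blue to an end of \<open>Q\<close>. As \<open>Q\<close>
  uses few vertices of \<open>P\<close>, two consecutive ones are off \<open>Q\<close>; one of them
  is blue to \<open>y'\<close>, so the other one is blue to both ends of \<open>Q\<close>.\<close>

lemma alternating_extend:
  assumes Q: "alternating Q" and y': "y' \<in> Y" "y' \<notin> set Q"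
    and p: "2 * card Y \<le> length P + 1"
  shows "\<exists>Q'. alternating Q' \<and> length Q < length Q'"
proof (rule ccontr)
  assume "\<not> ?thesis"
  then have max: "length Q' \<le> length Q" if "alternating Q'" for Q'
    using that linorder_not_less by blast
  have Q': "Q \<noteq> []" "distinct Q" "successively alt Q" "hd Q \<in> Y" "last Q \<in> Y"
    using Q by (auto simp: alternating_def)
  have y'V: "y' \<in> V - set P" using y' Y by auto
  have H: "\<not> B x (hd Q) \<and> \<not> B x (last Q)" if x: "x \<in> set P" "x \<notin> set Q" "B x y'" for x
  proof -
    have ne: "x \<noteq> y'" using x y'V by auto
    have "\<not> alternating (y' # x # Q)" using max[of "y' # x # Q"] by auto
    then have "\<not> alt x (hd Q)"
      using Q' x y' ne alt_sym[of x y'] by (auto simp: alternating_def alt_def successively_Cons)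
    moreover have "\<not> alternating (Q @ [x, y'])" using max[of "Q @ [x, y']"] by auto
    then have "\<not> alt (last Q) x"
      using Q' x y' ne by (auto simp: alternating_def alt_def successively_append_iff)
    ultimately show ?thesis using Q' x alt_sym[of x "last Q"] by (auto simp: alt_def)
  qed
  have "finite Y" using Y finV finite_subset by blast
  then have "card (set Q \<inter> Y) < card Y" by (intro psubset_card_mono) (use y' in auto)
  then have s: "card (set P \<inter> set Q) + 2 \<le> card Y" using alternating_card[OF Q] by simp
  obtain as u v bs where uv: "P = as @ u # v # bs" "u \<notin> set Q" "v \<notin> set Q"
  proof (rule ex_consecutive[of "- set Q"])
    have "set P - - set Q = set P \<inter> set Q" "set P \<inter> - set Q = set P - set Q" by auto
    then show "card (set P - - set Q) + 1 < card (set P \<inter> - set Q)"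
      using s p card_P_minus[of Q] by simp
  qed (use that in auto)
  have bl: "B u y \<or> B v y" if "y \<in> Y" for y
    using consecutive_blue[OF uv(1)] that Y by blast
  txt \<open>Such an \<open>x\<close> closes \<open>Q\<close> to a cycle, which can be cut open at \<open>hd P\<close> and continued to \<open>y'\<close>.\<close>
  obtain x where x: "x \<in> set P" "x \<notin> set Q" "B x (hd Q)" "B x (last Q)"
  proof (cases "B u y'")
    case True
    then have "\<not> B u (hd Q) \<and> \<not> B u (last Q)" using H[of u] uv by auto
    then show ?thesis using bl Q' that[of v] uv by auto
  next
    case False
    then have "B v y'" using bl y' by auto
    then have "\<not> B v (hd Q) \<and> \<not> B v (last Q)" using H[of v] uv by auto
    then show ?thesis using bl Q' that[of u] uv by auto
  qed
  define h where "h = hd P"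
  have h: "h \<in> set P" "\<And>y. y \<in> Y \<Longrightarrow> B h y" using hd_blue nonempty Y by (auto simp: h_def)
  \<comment> \<open>Off \<open>Q\<close>, the vertex \<open>h\<close> would contradict
    \<open>H\<close>, being blue to all of \<open>Y\<close>.\<close>
  have "h \<in> set Q" using H[of h] h y' Q' by auto
  then obtain Q1 Q2 where Q12: "Q = Q1 @ h # Q2" by (meson split_list)
  have "h \<notin> Y" using h disj by auto
  then have ne: "Q1 \<noteq> []" "Q2 \<noteq> []" using Q' Q12 by (auto split: if_splits)
  \<comment> \<open>The cycle is cut between \<open>last Q1\<close> and \<open>h\<close>:
    \<open>x\<close> links the old ends, \<open>h\<close> is preceded by \<open>y'\<close>, and
    \<open>last Q1\<close>, a neighbour of \<open>h\<close>, is a legal end in \<open>Y\<close>. The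
    path gains two vertices.\<close>
  have "alternating (y' # h # Q2 @ x # Q1)"
  proof -
    have "alt (last Q1) h" using Q' Q12 ne by (auto simp: successively_append_iff)
    then have "last Q1 \<in> Y" using h disj by (auto simp: alt_def)
    moreover have "alt (last Q2) x" "alt x (hd Q1)" "alt y' h"
      using x Q' Q12 ne symB h y' by (auto simp: alt_def)
    moreover have "x \<noteq> y'" "h \<noteq> y'" using x h y' disj by auto
    ultimately show ?thesis using Q' Q12 ne x y'
      by (auto simp: alternating_def successively_append_iff successively_Cons)
  qed
  then show False using max Q12 by fastforce
qed

lemma ex_full_alternating:
  assumes "Y \<noteq> {}" and p: "2 * card Y \<le> length P + 1"
  obtains Q where "alternating Q" "Y \<subseteq> set Q" 
proof -
  obtain y where "y \<in> Y" using assms by auto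
  then have "alternating [y]" by (auto simp: alternating_def)
  moreover have "\<forall>Q. alternating Q \<longrightarrow> length Q < Suc (2 * card (set P) + 1)"
    using alternating_length by (simp add: card_mono less_Suc_eq_le)
  ultimately obtain Q where "alternating Q" "\<And>Q'. alternating Q' \<Longrightarrow> length Q' \<le> length Q"
    using ex_has_greatest_nat[of alternating "[y]" length] by blast
  then show thesis using alternating_extend[of Q] p that by (metis linorder_not_less subsetI)
qed

lemma alternating_path_in:
  assumes "successively alt Q" "distinct Q" "set Q \<subseteq> set P \<union> Y"
  shows "path_in V B Q"
  using assms path' Y successively_mono[of alt Q B] by (auto simp: path_in_def alt_def)

lemma ex_blue_path_even:
  assumes "Y \<noteq> {}" and p: "2 * card Y \<le> length P + 1"
  obtains Q where "path_in V B Q" "length Q = 2 * card Y"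
proof -
  obtain Q where Q: "alternating Q" "Y \<subseteq> set Q" using ex_full_alternating assms by blast
  have Q': "Q \<noteq> []" "distinct Q" "successively alt Q" "hd Q \<in> Y" "last Q \<in> Y"
    using Q by (auto simp: alternating_def)
  have t: "card Y = card (set P \<inter> set Q) + 1" using alternating_card[OF Q(1)] Q(2) 
    by (simp add: inf.absorb2)
  obtain x where x: "x \<in> set P" "x \<notin> set Q" "B x (hd Q)"
  proof (rule ex_blue[of "- set Q" "hd Q"])
    have "set P - - set Q = set P \<inter> set Q" "set P \<inter> - set Q = set P - set Q" by auto
    then show "card (set P - - set Q) < card (set P \<inter> - set Q) + 1"
      using t p card_P_minus[of Q] by simp
  qed (use that Y Q' in auto)
  have "path_in V B (x # Q)"
    by (rule alternating_path_in)
      (use Q' x alternating_subset[OF Q(1)] in \<open>auto simp: successively_Cons alt_def\<close>)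
  moreover have "length (x # Q) = 2 * card Y" using alternating_length[OF Q(1)] t by simp
  ultimately show thesis using that by blast
qed

lemma ex_blue_path_odd:
  assumes "Y \<noteq> {}" and p: "2 * card Y \<le> length P"
  obtains Q where "path_in V B Q" "length Q = 2 * card Y + 1"
proof -
  obtain Q where Q: "alternating Q" "Y \<subseteq> set Q" using ex_full_alternating assms by (metis le_SucI Suc_eq_plus1)
  have Q': "Q \<noteq> []" "distinct Q" "successively alt Q" "hd Q \<in> Y" "last Q \<in> Y"
    using Q by (auto simp: alternating_def)
  have t: "card Y = card (set P \<inter> set Q) + 1" using alternating_card[OF Q(1)] Q(2) 
    by (simp add: inf.absorb2)
  have len: "length Q + 2 = 2 * card Y + 1" using alternating_length[OF Q(1)] t by simp
  obtain as u v bs where uv: "P = as @ u # v # bs" "u \<notin> set Q" "v \<notin> set Q"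
  proof (rule ex_consecutive[of "- set Q"])
    have "set P - - set Q = set P \<inter> set Q" "set P \<inter> - set Q = set P - set Q" by auto
    then show "card (set P - - set Q) + 1 < card (set P \<inter> - set Q)"
      using t p card_P_minus[of Q] by simp
  qed (use that in auto)
  have uv': "u \<in> set P" "v \<in> set P" "u \<noteq> v" using uv path' by auto
  have bl: "B u y \<or> B v y" if "y \<in> Y" for y
    using consecutive_blue[OF uv(1)] that Y by blast
  note result = that
  have both_ends: thesis if "x \<in> set P - set Q" "x' \<in> set P - set Q" "x \<noteq> x'"
    "B x (hd Q)" "B x' (last Q)" for x x'
  proof (rule result)
    show "path_in V B (x # Q @ [x'])"
      by (rule alternating_path_in)
        (use Q' that alternating_subset[OF Q(1)] symB in
          \<open>auto simp: successively_Cons successively_append_iff alt_def\<close>)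
  qed (use len in auto)
  show thesis
  proof (cases "(B u (hd Q) \<and> B v (last Q)) \<or> (B v (hd Q) \<and> B u (last Q))")
    case True
    then show thesis using both_ends[of u v] both_ends[of v u] uv uv' by auto
  next
    case False
    then obtain x where x: "x \<in> set P" "x \<notin> set Q" "B x (hd Q)" "B x (last Q)"
      using bl[of "hd Q"] bl[of "last Q"] Q' uv uv' by blast
    obtain x' where x': "x' \<in> set P" "x' \<notin> set Q" "x' \<noteq> x" "B x' (hd Q)"
    proof (rule ex_blue[of "- set (x # Q)" "hd Q"])
      have "set P - - set (x # Q) = insert x (set P \<inter> set Q)" 
        "set P \<inter> - set (x # Q) = set P - set (x # Q)" using x by auto
      then show "card (set P - - set (x # Q)) < card (set P \<inter> - set (x # Q)) + 1"
        using t p card_P_minus[of "x # Q"] x by simp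
    qed (use that Y Q' in auto)
    show thesis using both_ends[of x' x] x x' by auto
  qed
qed

end

text \<open>Otherwise \<lceil>q/2\<rceil> vertices off \<open>P\<close> could be taken as
  \<open>Y\<close>, and the even or odd construction, according to the parity of \<open>q\<close>,
  would give a blue path on \<open>q + 1\<close> vertices.\<close>

lemma card_less:
  assumes q: "\<And>ys. path_in V B ys \<Longrightarrow> length ys \<le> q" and "q \<le> length P" "q \<ge> 1"
  shows "card V < length P + (q + 1) div 2"
proof (rule ccontr)
  assume "\<not> ?thesis"
  moreover have "card (V - set P) = card V - length P"
    using path' by (metis List.finite_set card_Diff_subset distinct_card)
  ultimately have "(q + 1) div 2 \<le> card (V - set P)" by simp
  then obtain Y where Y: "Y \<subseteq> V - set P" "card Y = (q + 1) div 2"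
    by (meson obtain_subset_with_card_n)
  have "Y \<noteq> {}" using Y assms by auto
  show False
  proof (cases "even q")
    case True
    then have "2 * card Y = q" using Y by simp
    moreover from this obtain Q where "path_in V B Q" "length Q = 2 * card Y + 1"
      using ex_blue_path_odd[OF Y(1) \<open>Y \<noteq> {}\<close>] assms(2) by auto
    ultimately show False using q[of Q] by simp
  next
    case False
    then have "2 * card Y = q + 1" using Y by simp
    moreover from this obtain Q where "path_in V B Q" "length Q = 2 * card Y"
      using ex_blue_path_even[OF Y(1) \<open>Y \<noteq> {}\<close>] assms(2) by auto
    ultimately show False using q[of Q] by simp
  qed
qed

end

text \<open>The upper bound max(a, b) + \<lfloor>min(a, b)/2\<rfloor> - 1 for the Ramsey number of
  two paths on \<open>a\<close> and \<open>b\<close> vertices. The longer of the two longest paths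
  plays the role of \<open>P\<close>, whichever of \<open>a\<close> and \<open>b\<close> is
  larger.\<close>

theorem Gerencser_Gyarfas:
  fixes R B :: "'a \<Rightarrow> 'a \<Rightarrow> bool"
  assumes finV: "finite V" "V \<noteq> {}"
    and symR: "\<And>u v. R u v \<Longrightarrow> R v u" and symB: "\<And>u v. B u v \<Longrightarrow> B v u"
    and total: "\<And>u v. u \<in> V \<Longrightarrow> v \<in> V \<Longrightarrow> u \<noteq> v \<Longrightarrow> R u v \<or> B u v"
    and card: "max a b + min a b div 2 \<le> card V + 1"
  shows "(\<exists>xs. path_in V R xs \<and> length xs = a) \<or> (\<exists>xs. path_in V B xs \<and> length xs = b)"
proof (rule ccontr)
  assume neg: "\<not> ?thesis"
  obtain P where P: "path_in V R P" "\<And>ys. path_in V R ys \<Longrightarrow> length ys \<le> length P"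
    using ex_longest_path[OF finV(1)] by blast
  obtain Q where Q: "path_in V B Q" "\<And>ys. path_in V B ys \<Longrightarrow> length ys \<le> length Q"
    using ex_longest_path[OF finV(1)] by blast
  obtain v where v: "v \<in> V" using finV by auto
  then have "path_in V S [v]" for S by (simp add: path_in_def)
  then have pos: "length P \<ge> 1" "length Q \<ge> 1" using P(2)[of "[v]"] Q(2)[of "[v]"] by auto
  have lt: "length P < a" "length Q < b"
    using neg path_in_take[OF P(1), of a] path_in_take[OF Q(1), of b]
    by (metis length_take linorder_not_less min.absorb2)+
  show False
  proof (cases "length Q \<le> length P")
    case True
    interpret longest_red V R B P by unfold_locales (use finV symR symB total P pos in auto)
    have "card V < length P + (length Q + 1) div 2" using card_less[OF Q(2)] True pos by auto
    then show False using card lt True by (auto simp: max_def min_def split: if_splits)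
  next
    case False
    interpret longest_red V B R Q by unfold_locales (use finV symR symB Q pos in \<open>auto dest: total\<close>)
    have "card V < length Q + (length P + 1) div 2" using card_less[OF P(2)] False pos by auto
    then show False using card lt False by (auto simp: max_def min_def split: if_splits)
  qed
qed

subsection \<open>Colourings without rainbow stars\<close>

abbreviation color_rel :: "('a set \<Rightarrow> nat) \<Rightarrow> nat \<Rightarrow> 'a \<Rightarrow> 'a \<Rightarrow> bool" where
  "color_rel c col u v \<equiv> c {u, v} = col"

lemma edges_complete_graph:
  "edges (complete_graph m) = {{u, v} | u v. u < m \<and> v < m \<and> u \<noteq> v}"
  by (auto simp: complete_graph_def card_2_iff)

lemma edge_in_complete_graph [simp]:
  "{u, v} \<in> edges (complete_graph m) \<longleftrightarrow> u < m \<and> v < m \<and> u \<noteq> v"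
  by (auto simp: complete_graph_def card_2_iff)

lemma has_mono_copy_path_iff:
  "has_mono_copy (path_graph n) (complete_graph m) c \<longleftrightarrow>
     (\<exists>col xs. path_in {..<m} (color_rel c col) xs \<and> length xs = n)"
proof
  assume "has_mono_copy (path_graph n) (complete_graph m) c"
  then obtain f col where copy: "is_copy f (path_graph n) (complete_graph m)"
    and mono: "\<forall>e\<in>edges (path_graph n). c (f ` e) = col"
    unfolding has_mono_copy_def by blast
  have f: "inj_on f {..<n}" "f ` {..<n} \<subseteq> {..<m}"
    using copy by (simp_all add: is_copy_def path_graph_def complete_graph_def)
  have col: "c (f ` {i, Suc i}) = col" if "Suc i < n" for i
    using mono that unfolding path_graph_def by (metis (mono_tags, lifting) mem_Collect_eq snd_conv)
  have "path_in {..<m} (color_rel c col) (map f [0..<n])"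
    using f col by (simp add: path_in_def distinct_map successively_conv_nth atLeast0LessThan)
  then show "\<exists>col xs. path_in {..<m} (color_rel c col) xs \<and> length xs = n"
    by (intro exI[of _ col] exI[of _ "map f [0..<n]"]) simp
next
  assume "\<exists>col xs. path_in {..<m} (color_rel c col) xs \<and> length xs = n"
  then obtain col xs where xs: "distinct xs" "set xs \<subseteq> {..<m}"
    "successively (color_rel c col) xs" "length xs = n"
    by (auto simp: path_in_def)
  have "is_copy (nth xs) (path_graph n) (complete_graph m)"
    unfolding is_copy_def
  proof (intro conjI ballI)
    show "inj_on (nth xs) (verts (path_graph n))"
      using xs by (auto simp: path_graph_def inj_on_nth)
    show "nth xs ` verts (path_graph n) \<subseteq> verts (complete_graph m)"
      using xs(2,4) nth_mem[of _ xs] by (fastforce simp: path_graph_def complete_graph_def)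
    show "nth xs ` e \<in> edges (complete_graph m)" if "e \<in> edges (path_graph n)" for e
    proof -
      obtain i where i: "e = {i, Suc i}" "Suc i < n" using \<open>e \<in> _\<close> by (auto simp: path_graph_def)
      then have "xs ! i \<in> set xs" "xs ! Suc i \<in> set xs" "xs ! i \<noteq> xs ! Suc i"
        using xs by (simp_all add: nth_eq_iff_index_eq)
      then show ?thesis using i xs(2) by auto
    qed
  qed
  moreover have "\<forall>e \<in> edges (path_graph n). c (nth xs ` e) = col"
    using xs by (auto simp: path_graph_def successively_conv_nth)
  ultimately show "has_mono_copy (path_graph n) (complete_graph m) c"
    by (auto simp: has_mono_copy_def)
qed

lemma mono_copyI:
  assumes "path_in {..<m} (color_rel c col) xs" "n \<le> length xs"
  shows "has_mono_copy (path_graph n) (complete_graph m) c"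
  using path_in_take[OF assms(1), of n] assms(2)
  unfolding has_mono_copy_path_iff by (metis length_take min.absorb2)

definition seen_colors :: "nat \<Rightarrow> (nat set \<Rightarrow> nat) \<Rightarrow> nat \<Rightarrow> nat set" where
  "seen_colors m c v = (\<lambda>w. c {v, w}) ` ({..<m} - {v})"

lemma edges_star_graph_3: "edges (star_graph 3) = {{0, 1}, {0, 2}, {0, 3}}"
proof -
  have "{i. 1 \<le> i \<and> i \<le> (3::nat)} = {1, 2, 3}" by auto
  moreover have "edges (star_graph 3) = (\<lambda>i. {0, i}) ` {i. 1 \<le> i \<and> i \<le> (3::nat)}"
    by (auto simp: star_graph_def)
  ultimately show ?thesis by simp
qed

lemma verts_star_graph_3: "verts (star_graph 3) = {0, 1, 2, 3}"
  by (auto simp: star_graph_def)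

text \<open>Edges of different colours at \<open>v\<close> have different other ends, so three
  colours at \<open>v\<close> already yield three leaves.\<close>

lemma has_rainbow_star_iff:
  "has_rainbow_copy (star_graph 3) (complete_graph m) c \<longleftrightarrow>
     (\<exists>v<m. card (seen_colors m c v) \<ge> 3)"
proof
  assume "has_rainbow_copy (star_graph 3) (complete_graph m) c"
  then obtain f where f: "is_copy f (star_graph 3) (complete_graph m)"
    "inj_on (\<lambda>e. c (f ` e)) (edges (star_graph 3))"
    by (auto simp: has_rainbow_copy_def)
  have "{c {f 0, f 1}, c {f 0, f 2}, c {f 0, f 3}} \<subseteq> seen_colors m c (f 0)"
    using f(1) unfolding is_copy_def edges_star_graph_3 verts_star_graph_3
    by (auto simp: seen_colors_def complete_graph_def)
  moreover have "card {c {f 0, f 1}, c {f 0, f 2}, c {f 0, f 3}} = 3"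
    using f(2) by (auto simp: edges_star_graph_3 doubleton_eq_iff)
  ultimately have "3 \<le> card (seen_colors m c (f 0))"
    by (metis card_mono finite_Diff finite_imageI finite_lessThan seen_colors_def)
  moreover have "f 0 < m" using f(1) by (auto simp: is_copy_def verts_star_graph_3 complete_graph_def)
  ultimately show "\<exists>v<m. card (seen_colors m c v) \<ge> 3" by blast
next
  assume "\<exists>v<m. card (seen_colors m c v) \<ge> 3"
  then obtain v where v: "v < m" "card (seen_colors m c v) \<ge> 3" by blast
  then obtain S where "S \<subseteq> seen_colors m c v" "card S = 3"
    by (meson obtain_subset_with_card_n)
  then obtain c1 c2 c3 where cs: "{c1, c2, c3} \<subseteq> seen_colors m c v" "c1 \<noteq> c2" "c2 \<noteq> c3" "c1 \<noteq> c3"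
    by (metis card_3_iff)
  then obtain w1 w2 w3 where w: "c1 = c {v, w1}" "c2 = c {v, w2}" "c3 = c {v, w3}"
     "w1 < m" "w2 < m" "w3 < m" "w1 \<noteq> v" "w2 \<noteq> v" "w3 \<noteq> v"
    by (auto simp: seen_colors_def)
  define f where "f i = (if i = 0 then v else if i = 1 then w1 else if i = 2 then w2 else w3)"
    for i :: nat
  have [simp]: "f 0 = v" "f (Suc 0) = w1" "f 2 = w2" "f 3 = w3" by (auto simp: f_def)
  have "w1 \<noteq> w2" "w2 \<noteq> w3" "w1 \<noteq> w3" using cs w by auto
  then have "is_copy f (star_graph 3) (complete_graph m)"
    unfolding is_copy_def edges_star_graph_3 verts_star_graph_3
    using w v(1) by (auto simp: complete_graph_def)
  moreover have "inj_on (\<lambda>e. c (f ` e)) (edges (star_graph 3))"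
    using cs w by (auto simp: edges_star_graph_3)
  ultimately show "has_rainbow_copy (star_graph 3) (complete_graph m) c"
    by (auto simp: has_rainbow_copy_def)
qed

text \<open>Each vertex of \<open>B\<close> is appended together with a fresh vertex of
  \<open>A\<close>, so the path ends in \<open>A\<close> again and the induction continues.\<close>

lemma alternating_extension:
  assumes "finite B" "path_in V R xs" "xs \<noteq> []" "last xs \<in> A" "A \<union> B \<subseteq> V" "A \<inter> B = {}"
    and "\<And>u v. u \<in> A \<Longrightarrow> v \<in> B \<Longrightarrow> R u v \<and> R v u"
    and "B \<inter> set xs = {}" "card B \<le> card (A - set xs)"
  shows "\<exists>ys. path_in V R ys \<and> length ys = length xs + 2 * card B"
  using assms(1-9)
proof (induction B arbitrary: xs rule: finite_induct)
  case (insert b B)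
  then have "card (A - set xs) > 0" by simp
  then have "A - set xs \<noteq> {}" by (metis card.empty less_irrefl)
  then obtain a where a: "a \<in> A" "a \<notin> set xs" by auto
  have "A - set (xs @ [b, a]) = (A - set xs) - {a}" using insert by auto
  then have "card B \<le> card (A - set (xs @ [b, a]))" using a insert by simp
  moreover have "path_in V R (xs @ [b, a])"
    using insert a by (auto simp: path_in_def successively_append_iff)
  ultimately have "\<exists>ys. path_in V R ys \<and> length ys = length (xs @ [b, a]) + 2 * card B"
    using insert a by (intro insert.IH) auto
  then show ?case using insert by auto
qed auto

section \<open>Local 2-colourings and the colour sets of their vertices\<close>

locale local_2_coloring =
  fixes m :: nat and c :: "nat set \<Rightarrow> nat" and k :: nat
  assumes exact: "exact_coloring k (complete_graph m) c"
    and no_star: "\<not> has_rainbow_copy (star_graph 3) (complete_graph m) c"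
begin

abbreviation S where "S \<equiv> seen_colors m c"

lemma finite_S [simp]: "finite (S v)" by (simp add: seen_colors_def)

lemma card_S: "v < m \<Longrightarrow> card (S v) \<le> 2"
  using no_star by (auto simp: has_rainbow_star_iff not_le)

lemma color_in_S: "u < m \<Longrightarrow> v < m \<Longrightarrow> u \<noteq> v \<Longrightarrow> c {u, v} \<in> S u \<and> c {u, v} \<in> S v"
  by (auto simp: seen_colors_def insert_commute)

definition "colors = c ` edges (complete_graph m)"

lemma colors: "finite colors" "card colors = k"
  using exact by (auto simp: exact_coloring_def colors_def)

lemma ex_edge:
  assumes "col \<in> colors" obtains u v where "u < m" "v < m" "u \<noteq> v" "c {u, v} = col"
  using assms by (auto simp: colors_def edges_complete_graph)

lemma S_subset_colors: "v < m \<Longrightarrow> S v \<subseteq> colors"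
  by (auto simp: seen_colors_def colors_def edges_complete_graph)

text \<open>Two colour sets share the colour of the joining edge. If one is a singleton, its colour
  is common to all; otherwise they are pairwise intersecting two-element sets, which form a star or
  a triangle. A triangle involves three colours only.\<close>

lemma S_cases:
  assumes "k \<ge> 3"
  obtains (star) \<alpha> where "\<And>v. v < m \<Longrightarrow> \<alpha> \<in> S v"
  | (triangle) \<alpha> \<beta> \<gamma> where "distinct [\<alpha>, \<beta>, \<gamma>]" "k = 3"
      "\<And>v. v < m \<Longrightarrow> S v = {\<alpha>, \<beta>} \<or> S v = {\<alpha>, \<gamma>} \<or> S v = {\<beta>, \<gamma>}"
      "\<exists>v<m. S v = {\<alpha>, \<beta>}" "\<exists>v<m. S v = {\<alpha>, \<gamma>}" "\<exists>v<m. S v = {\<beta>, \<gamma>}"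
proof (cases "\<exists>\<alpha>. \<forall>v<m. \<alpha> \<in> S v")
  case True
  then show ?thesis using star by blast
next
  case False
  have two: "\<exists>x y. x \<noteq> y \<and> S v = {x, y}" if v: "v < m" for v
  proof -
    have "\<not> card (S v) \<le> 1"
    proof
      assume "card (S v) \<le> 1"
      then obtain \<alpha> where \<alpha>: "S v \<subseteq> {\<alpha>}"
        using card_le_Suc0_iff_eq[of "S v"] by (cases "S v = {}") auto
      have "\<alpha> \<in> S w" if "w < m" for w
      proof (cases "w = v")
        \<comment> \<open>For \<open>v\<close> itself, \<open>S v\<close> must be shown nonempty;
          since some edge exists, there is a second vertex.\<close>
        case True
        have "card colors > 0" using colors assms by simp
        then obtain col where "col \<in> colors" by (metis card_gt_0_iff ex_in_conv)
        then obtain x y where "x < m" "y < m" "x \<noteq> y" by (rule ex_edge)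
        then obtain z where "z < m" "z \<noteq> v" by metis
        then show ?thesis using color_in_S[of v z] \<alpha> v True by auto
      next
        case False
        then show ?thesis using color_in_S[of v w] \<alpha> v that by auto
      qed
      then show False using False by blast
    qed
    then have "card (S v) = 2" using card_S[OF v] by simp
    then show ?thesis by (auto simp: card_2_iff)
  qed
  have meet: "S v \<inter> S w \<noteq> {}" if "v < m" "w < m" for v w
    using color_in_S[of v w] two[of v] that by (cases "v = w") auto
  have "card colors > 0" using colors assms by simp
  then obtain col where "col \<in> colors" by (metis card_gt_0_iff ex_in_conv)
  then obtain v where v: "v < m" by (meson ex_edge)
  obtain \<alpha> \<beta> where ab: "\<alpha> \<noteq> \<beta>" "S v = {\<alpha>, \<beta>}" using two[OF v] by auto
  obtain w where w: "w < m" "\<alpha> \<notin> S w" using False by blast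
  obtain x y where xy: "x \<noteq> y" "S w = {x, y}" using two[OF w(1)] by blast
  have "\<beta> \<in> S w" using meet[OF v w(1)] ab w by auto
  then obtain \<gamma> where g: "\<gamma> \<noteq> \<beta>" "S w = {\<beta>, \<gamma>}" "\<gamma> \<noteq> \<alpha>"
    using xy w(2) by (metis insertE insertI1 insert_commute singletonD)
  obtain u where u: "u < m" "\<beta> \<notin> S u" using False by blast
  then have Su: "S u = {\<alpha>, \<gamma>}"
    using two[OF u(1)] meet[OF u(1) v] meet[OF u(1) w(1)] ab g by auto
  have all: "S z = {\<alpha>, \<beta>} \<or> S z = {\<alpha>, \<gamma>} \<or> S z = {\<beta>, \<gamma>}" if "z < m" for z
    using two[OF that] meet[OF that v] meet[OF that w(1)] meet[OF that u(1)] ab g Su by auto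
  have "colors = {\<alpha>, \<beta>, \<gamma>}"
  proof
    show "colors \<subseteq> {\<alpha>, \<beta>, \<gamma>}"
    proof
      fix col assume "col \<in> colors"
      then obtain x y where "x < m" "y < m" "x \<noteq> y" "c {x, y} = col" by (rule ex_edge)
      then show "col \<in> {\<alpha>, \<beta>, \<gamma>}" using color_in_S[of x y] all[of x] by auto
    qed
    show "{\<alpha>, \<beta>, \<gamma>} \<subseteq> colors" using S_subset_colors v w(1) ab g by blast
  qed
  then have "k = 3" using colors ab g by auto
  then show ?thesis using triangle[of \<alpha> \<beta> \<gamma>] ab g all v w(1) u(1) Su by auto
qed

section \<open>Colourings in which all vertices see a common colour\<close>

text \<open>The common colour and the colour of the edge already exhaust the two places in each set.
  Hence vertices with different colour sets are joined by \<alpha>.\<close>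

lemma S_eq_if_not_common:
  assumes \<alpha>: "\<And>v. v < m \<Longrightarrow> \<alpha> \<in> S v" and uv: "u < m" "v < m" "u \<noteq> v" "c {u, v} \<noteq> \<alpha>"
  shows "S u = {\<alpha>, c {u, v}}" "S v = {\<alpha>, c {u, v}}"
proof -
  have "S z = {\<alpha>, c {u, v}}" if z: "z \<in> {u, v}" for z
  proof (rule sym, rule card_seteq)
    show "{\<alpha>, c {u, v}} \<subseteq> S z" using \<alpha> color_in_S[OF uv(1-3)] z uv by auto
    show "card (S z) \<le> card {\<alpha>, c {u, v}}" using card_S[of z] z uv by auto
  qed simp
  then show "S u = {\<alpha>, c {u, v}}" "S v = {\<alpha>, c {u, v}}" by auto
qed

text \<open>Merging all colours other than a common colour \<open>\<alpha>\<close> thus creates no new paths, and the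
  two-colour theorem applies.\<close>
lemma avoiding_path_mono:
  assumes \<alpha>: "\<And>v. v < m \<Longrightarrow> \<alpha> \<in> S v" and xs: "path_in {..<m} (\<lambda>u v. c {u, v} \<noteq> \<alpha>) xs"
  shows "\<exists>col. path_in {..<m} (color_rel c col) xs"
proof -
  \<comment> \<open>The induction also records the class of the head, which forces the next edge to
    have the same colour.\<close>
  have "\<exists>col. successively (color_rel c col) xs \<and> (length xs \<ge> 2 \<longrightarrow> S (hd xs) = {\<alpha>, col} \<and> col \<noteq> \<alpha>)"
    using xs
  proof (induction xs rule: induct_list012)
    case (3 x y zs)
    then have xy: "x < m" "y < m" "x \<noteq> y" "c {x, y} \<noteq> \<alpha>" and p: "path_in {..<m} (\<lambda>u v. c {u, v} \<noteq> \<alpha>) (y # zs)"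
      by (auto simp: path_in_def)
    note S = S_eq_if_not_common[OF \<alpha> xy]
    obtain col where col: "successively (color_rel c col) (y # zs)"
      "length (y # zs) \<ge> 2 \<longrightarrow> S y = {\<alpha>, col} \<and> col \<noteq> \<alpha>"
      using 3(2)[OF p] by auto
    have "successively (color_rel c (c {x, y})) (x # y # zs)"
    proof (cases zs)
      case (Cons z zs')
      then have "col = c {x, y}" using col S(2) by auto
      then show ?thesis using col by auto
    qed auto
    then show ?case using S(1) xy by auto
  qed auto
  then show ?thesis using xs by (auto simp: path_in_def)
qed

lemma m_pos: assumes "k \<ge> 3" shows "m \<ge> 2"
proof -
  have "card colors > 0" using colors assms by simp
  then obtain col where "col \<in> colors" by (metis card_gt_0_iff ex_in_conv)
  then show ?thesis by (rule ex_edge) auto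
qed

lemma star_mono_path:
  assumes "k \<ge> 3" "\<And>v. v < m \<Longrightarrow> \<alpha> \<in> S v" "n + n div 2 \<le> m + 1"
  shows "has_mono_copy (path_graph n) (complete_graph m) c"
proof -
  have "(\<exists>xs. path_in {..<m} (color_rel c \<alpha>) xs \<and> length xs = n) \<or>
        (\<exists>xs. path_in {..<m} (\<lambda>u v. c {u, v} \<noteq> \<alpha>) xs \<and> length xs = n)"
    by (rule Gerencser_Gyarfas) (use assms(3) m_pos[OF assms(1)] in \<open>auto simp: insert_commute lessThan_empty_iff\<close>)
  then show ?thesis
    using avoiding_path_mono[OF assms(2)] has_mono_copy_path_iff by blast
qed

text \<open>A colour \<beta> \<noteq> \<alpha> occurs on some edge, both ends of which belong to the
  class of \<beta>; the classes are disjoint.\<close>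

lemma card_other_classes:
  assumes \<alpha>: "\<And>v. v < m \<Longrightarrow> \<alpha> \<in> S v" and T: "T \<subseteq> colors - {\<alpha>}"
  shows "2 * card T \<le> card {v. v < m \<and> (\<exists>\<beta>\<in>T. S v = {\<alpha>, \<beta>})}"
proof -
  have fin: "finite T" using T colors finite_subset by blast
  have "2 \<le> card {v. v < m \<and> S v = {\<alpha>, \<beta>}}" if "\<beta> \<in> T" for \<beta>
  proof -
    have "\<beta> \<in> colors" "\<beta> \<noteq> \<alpha>" using that T by auto
    then obtain u v where uv: "u < m" "v < m" "u \<noteq> v" "c {u, v} = \<beta>" by (meson ex_edge)
    then have "{u, v} \<subseteq> {v. v < m \<and> S v = {\<alpha>, \<beta>}}" 
      using uv S_eq_if_not_common[OF \<alpha> uv(1-3)] \<open>\<beta> \<noteq> \<alpha>\<close> by auto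
    then have "card {u, v} \<le> card {v. v < m \<and> S v = {\<alpha>, \<beta>}}" by (intro card_mono) auto
    then show ?thesis using uv by simp
  qed
  then have "2 * card T \<le> (\<Sum>\<beta>\<in>T. card {v. v < m \<and> S v = {\<alpha>, \<beta>}})"
    using sum_mono[of T "\<lambda>_. 2 :: nat"] by (simp add: mult.commute)
  also have "\<dots> = card (\<Union>\<beta>\<in>T. {v. v < m \<and> S v = {\<alpha>, \<beta>}})"
    by (rule card_UN_disjoint[symmetric]) (use fin in \<open>auto simp: doubleton_eq_iff\<close>)
  also have "(\<Union>\<beta>\<in>T. {v. v < m \<and> S v = {\<alpha>, \<beta>}}) = {v. v < m \<and> (\<exists>\<beta>\<in>T. S v = {\<alpha>, \<beta>})}" by auto
  finally show ?thesis .
qed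

lemma star_order:
  assumes "k \<ge> 3" and \<alpha>: "\<And>v. v < m \<Longrightarrow> \<alpha> \<in> S v"
  shows "2 * (k - 1) \<le> m"
proof -
  have "\<alpha> \<in> colors" using \<alpha>[of 0] S_subset_colors[of 0] m_pos[OF assms(1)] by auto
  then have "card (colors - {\<alpha>}) = k - 1" using colors by simp
  moreover have "card {v. v < m \<and> (\<exists>\<beta>\<in>colors - {\<alpha>}. S v = {\<alpha>, \<beta>})} \<le> card {..<m}"
    by (rule card_mono) auto
  ultimately show ?thesis using card_other_classes[OF \<alpha>, of "colors - {\<alpha>}"] by simp
qed

text \<open>If a longest path in \<alpha> misses \<open>y\<close>, it contains the set
  \<open>W\<close> of all vertices outside the class of \<open>y\<close>, and vertices outside
  \<open>W\<close> separate and surround them. So it has at least \<open>2 * card W + 1\<close>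
  vertices, which is at least \<open>4 * (k - 2) + 1\<close>.\<close>

lemma star_mono_path_small:
  assumes "k \<ge> 3" and \<alpha>: "\<And>v. v < m \<Longrightarrow> \<alpha> \<in> S v" and n: "n \<le> 4 * (k - 2) + 1" "n \<le> m"
  shows "has_mono_copy (path_graph n) (complete_graph m) c"
proof -
  have "m > 0" using m_pos[OF assms(1)] by simp
  obtain P where P: "path_in {..<m} (color_rel c \<alpha>) P"
    "\<And>ys. path_in {..<m} (color_rel c \<alpha>) ys \<Longrightarrow> length ys \<le> length P"
    using ex_longest_path[of "{..<m}" "color_rel c \<alpha>"] by auto
  have P': "distinct P" "set P \<subseteq> {..<m}" using P(1) by (auto simp: path_in_def)
  have "path_in {..<m} (color_rel c \<alpha>) [0]" using \<open>m > 0\<close> by (simp add: path_in_def)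
  then have ne: "P \<noteq> []" using P(2)[of "[0]"] by auto
  interpret longest_red "{..<m}" "color_rel c \<alpha>" "\<lambda>u v. c {u, v} \<noteq> \<alpha>" P
    by unfold_locales (use P ne in \<open>auto simp: insert_commute\<close>)
  have "n \<le> length P"
  proof (cases "set P = {..<m}")
    case True
    then show ?thesis using distinct_card[OF P'(1)] n(2) by simp
  next
    case False
    then obtain y where y: "y \<in> {..<m} - set P" using P' by auto
    txt \<open>The path cannot absorb \<open>y\<close>, so its ends and one of any two consecutive vertices lie in
      the class of \<open>y\<close>, while it contains all vertices outside this class.\<close>
    define W where "W = {v. v < m \<and> S v \<noteq> S y}"
    have W: "v \<notin> W" if "v < m" "v \<noteq> y" "c {v, y} \<noteq> \<alpha>" for v
      using S_eq_if_not_common[OF \<alpha>, of v y] that y by (simp add: W_def)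
    have ends: "hd P \<notin> W" "last P \<notin> W"
      using W hd_blue[OF y] last_blue[OF y] ne P' y hd_in_set last_in_set by blast+
    have "successively (\<lambda>u v. \<not> (u \<in> W \<and> v \<in> W)) P"
    proof (rule successively_if_split)
      fix as u v bs assume sp: "P = as @ u # v # bs"
      then have "u < m" "v < m" "u \<noteq> y" "v \<noteq> y" using P' y by auto
      then show "\<not> (u \<in> W \<and> v \<in> W)" using consecutive_blue[OF sp y] W by blast
    qed
    then have "card (set P \<inter> W) + 1 \<le> card (set P - W)"
      using card_independent[of W P] ends ne P' by simp
    moreover have "card (set P) = card (set P \<inter> W) + card (set P - W)"
      by (metis List.finite_set card_Int_Diff)
    moreover have "set P \<inter> W = W"
    proof -
      have "v \<in> set P" if "v \<in> W" for v
      proof (rule ccontr)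
        assume "v \<notin> set P"
        then have v: "v \<in> {..<m} - set P" using that by (auto simp: W_def)
        \<comment> \<open>All vertices off \<open>P\<close> lie in the class of \<open>hd P\<close>,
          being joined to it by a colour other than \<alpha>.\<close>
        have "S z = {\<alpha>, c {hd P, z}} \<and> S z = S (hd P)" if z: "z \<in> {..<m} - set P" for z
        proof -
          have "hd P < m" "hd P \<noteq> z" using z P' hd_in_set[OF ne] by auto
          then show ?thesis using S_eq_if_not_common[OF \<alpha>, of "hd P" z] hd_blue[OF z] z by simp
        qed
        then have "S v = S y" using y v by metis
        then show False using that by (auto simp: W_def)
      qed
      then show ?thesis by auto
    qed
    moreover have "2 * (k - 2) \<le> card W"
    proof -
      \<comment> \<open>At least \<open>k - 2\<close> colours are not seen by \<open>y\<close>, and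
        each of them has a class of at least two vertices inside \<open>W\<close>.\<close>
      have "card (colors - S y) = k - card (S y)"
        using colors S_subset_colors[of y] y by (simp add: card_Diff_subset)
      then have "k - 2 \<le> card (colors - S y)" using card_S[of y] y by simp
      moreover have "2 * card (colors - S y) \<le> card {v. v < m \<and> (\<exists>\<beta>\<in>colors - S y. S v = {\<alpha>, \<beta>})}"
        by (rule card_other_classes) (use \<alpha> y in auto)
      moreover have "\<dots> \<le> card W" by (rule card_mono) (auto simp: W_def)
      ultimately show ?thesis by simp
    qed
    ultimately show ?thesis using n distinct_card[OF P'(1)] by simp
  qed
  then show ?thesis using mono_copyI[OF P(1)] by blast
qed

end

section \<open>Colourings with three classes of vertices\<close>

text \<open>If \<open>B\<close> or \<open>C\<close> has at least n/2 vertices, alternating between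
  it and \<open>A\<close> suffices. Otherwise the two-colour theorem inside \<open>A\<close> yields
  the part of the path that alternation cannot supply.\<close>

lemma triangle_mono_path:
  fixes A B C :: "nat set" and c :: "nat set \<Rightarrow> nat"
  assumes V: "A \<union> B \<union> C = {..<m}" "A \<inter> B = {}" "A \<inter> C = {}"
    and le: "card B \<le> card A" "card C \<le> card A" and ne: "B \<noteq> {}" "C \<noteq> {}"
    and AB: "\<And>u v. u \<in> A \<Longrightarrow> v \<in> B \<Longrightarrow> c {u, v} = \<alpha>"
    and AC: "\<And>u v. u \<in> A \<Longrightarrow> v \<in> C \<Longrightarrow> c {u, v} = \<beta>"
    and AA: "\<And>u v. u \<in> A \<Longrightarrow> v \<in> A \<Longrightarrow> u \<noteq> v \<Longrightarrow> c {u, v} = \<alpha> \<or> c {u, v} = \<beta>"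
    and m: "3 * n \<le> 2 * m + 2" "n \<ge> 1"
  shows "has_mono_copy (path_graph n) (complete_graph m) c"
proof -
  have fin: "finite A" "finite B" "finite C" using V by (metis finite_Un finite_lessThan)+
  have extend: "has_mono_copy (path_graph n) (complete_graph m) c"
    if "path_in {..<m} (color_rel c \<gamma>) xs" "xs \<noteq> []" "last xs \<in> A" "D' \<inter> set xs = {}"
      "D' \<subseteq> D" "D \<subseteq> {..<m}" "A \<inter> D = {}" "\<And>u v. u \<in> A \<Longrightarrow> v \<in> D \<Longrightarrow> c {u, v} = \<gamma>"
      "card D' \<le> card (A - set xs)" "n \<le> length xs + 2 * card D'" for xs \<gamma> D D'
  proof -
    have "\<exists>ys. path_in {..<m} (color_rel c \<gamma>) ys \<and> length ys = length xs + 2 * card D'"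
      by (rule alternating_extension[where A = A])
        (use that V finite_subset[of D' "{..<m}"] in \<open>auto simp: insert_commute\<close>)
    then show ?thesis using mono_copyI that by metis
  qed
  \<comment> \<open>Starting from \<open>[d, a]\<close>, the remaining vertices of \<open>D\<close>
    contribute two each, for a total of \<open>2 * card D\<close>.\<close>
  have large: "has_mono_copy (path_graph n) (complete_graph m) c"
    if D: "n \<le> 2 * card D" "D \<noteq> {}" "card D \<le> card A" "D \<subseteq> {..<m}" "A \<inter> D = {}" "finite D"
      "\<And>u v. u \<in> A \<Longrightarrow> v \<in> D \<Longrightarrow> c {u, v} = \<gamma>" for D \<gamma>
  proof -
    obtain d where d: "d \<in> D" using D by auto
    have "card D > 0" using D by (simp add: card_gt_0_iff)
    then obtain a where a: "a \<in> A" using D by fastforce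
    have "card (A - set [d, a]) = card A - 1" 
    proof -
      have "A - set [d, a] = A - {a}" using d D by auto
      then show ?thesis using a fin by simp
    qed
    then show ?thesis
      using d a D V \<open>card D > 0\<close>
      by (intro extend[of \<gamma> "[d, a]" "D - {d}" D]) (auto simp: path_in_def insert_commute)
  qed
  have small: "has_mono_copy (path_graph n) (complete_graph m) c"
    if "path_in A (color_rel c \<gamma>) xs" "length xs = n - 2 * card D" "2 * card D < n"
      "n \<le> card A + card D" "D \<subseteq> {..<m}" "A \<inter> D = {}"
      "\<And>u v. u \<in> A \<Longrightarrow> v \<in> D \<Longrightarrow> c {u, v} = \<gamma>" for xs D \<gamma>
  proof (rule extend[of \<gamma> xs D D])
    have xs: "set xs \<subseteq> A" "distinct xs" "xs \<noteq> []" using that by (auto simp: path_in_def)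
    show "path_in {..<m} (color_rel c \<gamma>) xs" using that V by (auto simp: path_in_def)
    show "last xs \<in> A" "D \<inter> set xs = {}" using xs that last_in_set by blast+
    have "card (A - set xs) = card A - length xs" using xs by (simp add: card_Diff_subset distinct_card)
    then show "card D \<le> card (A - set xs)" using that by simp
  qed (use that in auto)
  have "m = card (A \<union> B \<union> C)" using V by simp
  also have "\<dots> \<le> card A + card B + card C"
    by (meson add_le_mono1 card_Un_le order_trans)
  finally have sum: "m \<le> card A + card B + card C" .
  consider "n \<le> 2 * card B" | "n \<le> 2 * card C" | "2 * card B < n" "2 * card C < n" by linarith
  then show ?thesis
  proof cases
    case 1
    then show ?thesis using V fin le ne AB by (intro large[of B \<alpha>]) auto
  next
    case 2
    then show ?thesis using V fin le ne AC by (intro large[of C \<beta>]) auto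
  next
    case 3
    \<comment> \<open>From \<open>3 * n \<le> 2 * m + 2\<close> and \<open>2 * card C < n\<close>
      follows \<open>n \<le> card A + card B\<close>, and likewise with \<open>B\<close> and
      \<open>C\<close> exchanged. So enough of \<open>A\<close> is left over for the
      alternation.\<close>
    have "A \<noteq> {}" using le ne fin by auto
    have "(\<exists>xs. path_in A (color_rel c \<alpha>) xs \<and> length xs = n - 2 * card B) \<or>
          (\<exists>xs. path_in A (color_rel c \<beta>) xs \<and> length xs = n - 2 * card C)"
      by (rule Gerencser_Gyarfas) (use fin \<open>A \<noteq> {}\<close> AA sum m 3 in \<open>auto simp: insert_commute\<close>)
    then show ?thesis
      using small[of \<alpha> _ B] small[of \<beta> _ C] 3 sum m V AB AC by auto
  qed
qed

context local_2_coloring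
begin

text \<open>Two different pairs of the three colours meet in one colour, which is therefore the
  colour of all edges between the two classes.\<close>

lemma triangle_mono_path_classes:
  assumes "k = 3" and dist: "distinct [\<alpha>, \<beta>, \<gamma>]"
    and S: "\<And>v. v < m \<Longrightarrow> S v = {\<alpha>, \<beta>} \<or> S v = {\<alpha>, \<gamma>} \<or> S v = {\<beta>, \<gamma>}"
    and ex: "\<exists>v<m. S v = {\<alpha>, \<gamma>}" "\<exists>v<m. S v = {\<beta>, \<gamma>}"
    and le: "card {v. v < m \<and> S v = {\<alpha>, \<gamma>}} \<le> card {v. v < m \<and> S v = {\<alpha>, \<beta>}}"
      "card {v. v < m \<and> S v = {\<beta>, \<gamma>}} \<le> card {v. v < m \<and> S v = {\<alpha>, \<beta>}}"
    and m: "3 * n \<le> 2 * m + 2" "n \<ge> 1"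
  shows "has_mono_copy (path_graph n) (complete_graph m) c"
proof (rule triangle_mono_path[OF _ _ _ le _ _ _ _ _ m])
  show "{v. v < m \<and> S v = {\<alpha>, \<beta>}} \<union> {v. v < m \<and> S v = {\<alpha>, \<gamma>}} \<union> {v. v < m \<and> S v = {\<beta>, \<gamma>}} = {..<m}"
    using S by auto
  show "c {u, v} = \<alpha>" if "u \<in> {v. v < m \<and> S v = {\<alpha>, \<beta>}}" "v \<in> {v. v < m \<and> S v = {\<alpha>, \<gamma>}}" for u v
    using that color_in_S[of u v] dist by (cases "u = v") (auto simp: doubleton_eq_iff)
  show "c {u, v} = \<beta>" if "u \<in> {v. v < m \<and> S v = {\<alpha>, \<beta>}}" "v \<in> {v. v < m \<and> S v = {\<beta>, \<gamma>}}" for u v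
    using that color_in_S[of u v] dist by (cases "u = v") (auto simp: doubleton_eq_iff)
  show "c {u, v} = \<alpha> \<or> c {u, v} = \<beta>"
    if "u \<in> {v. v < m \<and> S v = {\<alpha>, \<beta>}}" "v \<in> {v. v < m \<and> S v = {\<alpha>, \<beta>}}" "u \<noteq> v" for u v
    using that color_in_S[of u v] by auto
qed (use ex dist in \<open>auto simp: doubleton_eq_iff\<close>)

theorem mono_path_3:
  assumes "k = 3" and m: "3 * n \<le> 2 * m + 2" "n \<ge> 1"
  shows "has_mono_copy (path_graph n) (complete_graph m) c"
proof -
  have "k \<ge> 3" using assms by simp
  then show ?thesis
  proof (cases rule: S_cases)
    case (star \<alpha>)
    then show ?thesis using star_mono_path[of \<alpha> n] \<open>k \<ge> 3\<close> m by simp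
  next
    case (triangle \<alpha> \<beta> \<gamma>)
    let ?N = "\<lambda>x y. card {v. v < m \<and> S v = {x, y}}"
    have comm: "{x, y} = {y, x}" for x y :: nat by auto
    consider "?N \<alpha> \<gamma> \<le> ?N \<alpha> \<beta>" "?N \<beta> \<gamma> \<le> ?N \<alpha> \<beta>" | "?N \<alpha> \<beta> \<le> ?N \<alpha> \<gamma>" "?N \<beta> \<gamma> \<le> ?N \<alpha> \<gamma>"
      | "?N \<alpha> \<beta> \<le> ?N \<beta> \<gamma>" "?N \<alpha> \<gamma> \<le> ?N \<beta> \<gamma>" by linarith
    then show ?thesis
    proof cases
      case 1
      then show ?thesis using triangle triangle_mono_path_classes[of \<alpha> \<beta> \<gamma>] assms by auto
    next
      case 2
      show ?thesis
        by (rule triangle_mono_path_classes[of \<alpha> \<gamma> \<beta>]) (use triangle 2 assms in \<open>auto simp: comm[of \<gamma> \<beta>]\<close>)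
    next
      case 3
      show ?thesis
        by (rule triangle_mono_path_classes[of \<beta> \<gamma> \<alpha>]) (use triangle 3 assms in \<open>auto simp: comm[of \<gamma> \<alpha>] comm[of \<beta> \<alpha>]\<close>)
    qed
  qed
qed

theorem mono_path_ge_4:
  assumes "k \<ge> 4" and "n \<le> 4 * (k - 2) + 1 \<and> n \<le> m \<or> n + n div 2 \<le> m + 1"
  shows "has_mono_copy (path_graph n) (complete_graph m) c"
proof -
  have "k \<ge> 3" using assms by simp
  then show ?thesis
  proof (cases rule: S_cases)
    case (star \<alpha>)
    then show ?thesis
      using star_mono_path[of \<alpha> n] star_mono_path_small[of \<alpha> n] \<open>k \<ge> 3\<close> assms(2) by blast
  qed (use assms in simp)
qed

theorem order_ge_4:
  assumes "k \<ge> 4" shows "2 * (k - 1) \<le> m"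
proof -
  have "k \<ge> 3" using assms by simp
  then show ?thesis
    by (cases rule: S_cases) (use star_order assms in auto)
qed

end

subsection \<open>Extremal colourings\<close>

lemma card_gt_2_contra: "S \<subseteq> {x, y} \<Longrightarrow> \<not> 3 \<le> card S"
proof -
  assume "S \<subseteq> {x, y}"
  then have "card S \<le> card {x, y}" by (intro card_mono) auto
  also have "\<dots> \<le> 2" by (simp add: card_insert_le_m1)
  finally show ?thesis by simp
qed

text \<open>A path with at least two vertices has an edge at each of its vertices, which places them
  all in \<open>W\<close>.\<close>

lemma path_in_length_le_class:
  assumes "path_in V R xs" "length xs \<ge> 2" "finite W"
    and "\<And>u v. R u v \<Longrightarrow> u \<in> V \<Longrightarrow> v \<in> V \<Longrightarrow> u \<in> W \<and> v \<in> W"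
  shows "length xs \<le> card W"
proof -
  have "set xs \<subseteq> W"
  proof
    fix x assume "x \<in> set xs"
    then obtain i where i: "i < length xs" "x = xs ! i" by (auto simp: in_set_conv_nth)
    have R: "R (xs ! j) (xs ! Suc j)" "xs ! j \<in> V" "xs ! Suc j \<in> V" if "Suc j < length xs" for j
      using assms(1) that nth_mem[of j xs] nth_mem[of "Suc j" xs] by (auto simp: path_in_def successively_conv_nth)
    show "x \<in> W"
    proof (cases "Suc i < length xs")
      case True
      then show ?thesis using R[of i] assms(4) i by blast
    next
      case False
      then have "Suc (i - 1) = i" using i assms(2) by simp
      then show ?thesis using R[of "i - 1"] assms(4)[of "xs ! (i - 1)" "xs ! i"] i by auto
    qed
  qed
  then show ?thesis using assms by (metis card_mono distinct_card path_in_def)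
qed

text \<open>Colour 0 joins different classes, and colour \<open>i > 0\<close> is used inside the class \<open>i\<close>.\<close>
definition class_coloring :: "('a \<Rightarrow> nat) \<Rightarrow> 'a set \<Rightarrow> nat" where
  "class_coloring g e = (if Min (g ` e) = Max (g ` e) then Max (g ` e) else 0)"

lemma class_coloring_pair: "class_coloring g {u, v} = (if g u = g v then g u else 0)"
  by (auto simp: class_coloring_def min_def max_def)

lemma class_coloring_no_star:
  "\<not> has_rainbow_copy (star_graph 3) (complete_graph m) (class_coloring g)"
proof -
  have "seen_colors m (class_coloring g) v \<subseteq> {g v, 0}" for v
    by (auto simp: seen_colors_def class_coloring_pair)
  then show ?thesis unfolding has_rainbow_star_iff by (metis card_gt_2_contra)
qed

text \<open>Class 1 consists of the vertices from \<open>r\<close> on. The others are grouped in pairs into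
  the classes 2, ..., \<open>k - 1\<close>, the surplus going into the last one.\<close>
definition star_classes :: "nat \<Rightarrow> nat \<Rightarrow> nat \<Rightarrow> nat" where
  "star_classes k r v = (if v < r then min (v div 2 + 2) (k - 1) else 1)"

lemma star_coloring_exact:
  assumes k: "k \<ge> 4" and r: "2 * (k - 2) \<le> r" and m: "r + 2 \<le> m"
  shows "exact_coloring k (complete_graph m) (class_coloring (star_classes k r))"
proof -
  let ?g = "star_classes k r" and ?E = "edges (complete_graph m)"
  have "class_coloring ?g ` ?E = {..<k}"
  proof
    show "class_coloring ?g ` ?E \<subseteq> {..<k}"
      using k by (auto simp: edges_complete_graph class_coloring_pair star_classes_def)
    show "{..<k} \<subseteq> class_coloring ?g ` ?E"
    proof
      fix i assume "i \<in> {..<k}"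
      then consider "i = 0" | "i = 1" | "2 \<le> i" "i < k" by fastforce
      then have "\<exists>u v. u < m \<and> v < m \<and> u \<noteq> v \<and> class_coloring ?g {u, v} = i"
      proof cases
        case 1
        then show ?thesis using k r m
          by (intro exI[of _ 0] exI[of _ r]) (auto simp: class_coloring_pair star_classes_def)
      next
        case 2
        then show ?thesis using m
          by (intro exI[of _ r] exI[of _ "r + 1"]) (auto simp: class_coloring_pair star_classes_def)
      next
        case 3
        \<comment> \<open>The pair \<open>2 * (i - 2)\<close>, \<open>2 * (i - 2) + 1\<close> makes
          up class \<open>i\<close>, or part of it if \<open>i = k - 1\<close>.\<close>
        then have "2 * (i - 2) + 1 < r" using r by linarith
        then show ?thesis using m 3
          by (intro exI[of _ "2 * (i - 2)"] exI[of _ "2 * (i - 2) + 1"])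
            (auto simp: class_coloring_pair star_classes_def)
      qed
      then obtain u v where "u < m" "v < m" "u \<noteq> v" "class_coloring ?g {u, v} = i" by blast
      then show "i \<in> class_coloring ?g ` ?E" by (intro image_eqI[of _ _ "{u, v}"]) auto
    qed
  qed
  then show ?thesis by (simp add: exact_coloring_def)
qed

text \<open>In colour 0 class 1 is independent, so a path has at most \<open>2 * r + 1\<close>
  vertices. Colour 1 stays among the \<open>m - r\<close> vertices of class 1, every other colour
  among the first \<open>r\<close> vertices.\<close>

lemma star_coloring_no_mono_path:
  assumes k: "k \<ge> 4" and n: "n \<ge> 2" and r: "2 * r + 2 \<le> n" and m: "m \<le> r + n - 1" 
  shows "\<not> has_mono_copy (path_graph n) (complete_graph m) (class_coloring (star_classes k r))"
proof
  let ?g = "star_classes k r"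
  assume "has_mono_copy (path_graph n) (complete_graph m) (class_coloring ?g)"
  then obtain col xs where xs: "path_in {..<m} (color_rel (class_coloring ?g) col) xs" "length xs = n"
    by (auto simp: has_mono_copy_path_iff)
  have xs': "distinct xs" "set xs \<subseteq> {..<m}" "successively (color_rel (class_coloring ?g) col) xs"
    "xs \<noteq> []"
    using xs n by (auto simp: path_in_def)
  show False
  proof (cases "col = 0")
    case True
    have "successively (\<lambda>u v. \<not> (u \<in> {r..} \<and> v \<in> {r..})) xs"
      by (rule successively_mono[OF xs'(3)]) (auto simp: True class_coloring_pair star_classes_def)
    then have "card (set xs \<inter> {r..}) \<le> card (set xs - {r..}) + 1"
      using card_independent[of "{r..}" xs] xs' by simp
    moreover have "card (set xs - {r..}) \<le> card {..<r}" by (rule card_mono) auto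
    moreover have "n = card (set xs \<inter> {r..}) + card (set xs - {r..})"
      using xs xs' by (metis List.finite_set card_Int_Diff distinct_card)
    ultimately show False using r by simp
  next
    case False
    define W where "W = {v \<in> {..<m}. ?g v = col}"
    have "length xs \<le> card W"
      by (rule path_in_length_le_class[OF xs(1)])
        (use False xs n in \<open>auto simp: W_def class_coloring_pair split: if_splits\<close>)
    moreover have "card W < n"
    proof (cases "col = 1")
      case True
      then have "W \<subseteq> {r..<m}" using k by (auto simp: W_def star_classes_def split: if_splits)
      then have "card W \<le> card {r..<m}" by (intro card_mono) auto
      then show ?thesis using m n by simp
    next
      case False
      then have "W \<subseteq> {..<r}" by (auto simp: W_def star_classes_def split: if_splits)
      then have "card W \<le> card {..<r}" by (intro card_mono) auto
      then show ?thesis using r n by simp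
    qed
    ultimately show False using xs by simp
  qed
qed

text \<open>The class \<open>i\<close> and the edges between the classes \<open>i\<close> and \<open>i + 1\<close> (modulo 3) have
  colour \<open>i\<close>.\<close>
definition cyclic_coloring :: "('a \<Rightarrow> nat) \<Rightarrow> 'a set \<Rightarrow> nat" where
  "cyclic_coloring g e =
     (if 2 \<in> g ` e then (if 1 \<in> g ` e then 1 else 2) else (if 0 \<in> g ` e then 0 else 1))"

text \<open>The first two classes have n div 2 and (n - 1) div 2 vertices, n - 1 together. With at
  most (n - 1) div 2 vertices in the third, any two classes have at most n - 1.\<close>

definition triangle_classes :: "nat \<Rightarrow> nat \<Rightarrow> nat" where
  "triangle_classes n v = (if v < n div 2 then 0 else if v < n - 1 then 1 else 2)"

lemma triangle_classes_le_2: "triangle_classes n v \<in> {0, 1, 2}"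
  by (simp add: triangle_classes_def)

text \<open>The classes whose vertices can be incident with an edge of colour \<open>col\<close> in
  \<open>cyclic_coloring\<close>.\<close>

definition cyclic_classes :: "nat \<Rightarrow> nat set" where
  "cyclic_classes col = (if col = 0 then {0, 1} else if col = 1 then {1, 2} else {0, 2})"

lemma cyclic_coloring_in_class:
  assumes "g u \<in> {0, 1, 2}" "g v \<in> {0, 1, 2}"
  shows "g u \<in> cyclic_classes (cyclic_coloring g {u, v})"
proof -
  have "g u = 0 \<or> g u = 1 \<or> g u = 2" "g v = 0 \<or> g v = 1 \<or> g v = 2" using assms by simp_all
  then show ?thesis
    by (elim disjE) (simp_all add: cyclic_coloring_def cyclic_classes_def)
qed

lemma triangle_coloring_no_star:
  "\<not> has_rainbow_copy (star_graph 3) (complete_graph m) (cyclic_coloring (triangle_classes n))"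
proof -
  have "\<exists>x y. seen_colors m (cyclic_coloring (triangle_classes n)) v \<subseteq> {x, y}" for v
  proof (intro exI)
    \<comment> \<open>Class \<open>i\<close> sees its own colour and that of its cyclic predecessor,
      \<open>i + 2\<close> modulo 3.\<close>
    show "seen_colors m (cyclic_coloring (triangle_classes n)) v
      \<subseteq> {triangle_classes n v, (triangle_classes n v + 2) mod 3}"
      by (auto simp: seen_colors_def cyclic_coloring_def triangle_classes_def)
  qed
  then show ?thesis unfolding has_rainbow_star_iff by (metis card_gt_2_contra)
qed

lemma triangle_coloring_exact:
  assumes n: "n \<ge> 4" and m: "n - 1 < m"
  shows "exact_coloring 3 (complete_graph m) (cyclic_coloring (triangle_classes n))"
proof -
  let ?c = "cyclic_coloring (triangle_classes n)" and ?E = "edges (complete_graph m)"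
  have d: "n div 2 < n - 1" "0 < n div 2" using n by auto
  have g: "triangle_classes n 0 = 0" "triangle_classes n (n div 2) = 1"
    "triangle_classes n (n - 1) = 2" using d by (auto simp: triangle_classes_def)
  have "?c ` ?E = {0, 1, 2}"
  proof
    show "?c ` ?E \<subseteq> {0, 1, 2}" by (auto simp: cyclic_coloring_def)
    have "{0, n div 2} \<in> ?E" "{n div 2, n - 1} \<in> ?E" "{0, n - 1} \<in> ?E" using d m by auto
    moreover have "?c {0, n div 2} = 0" "?c {n div 2, n - 1} = 1" "?c {0, n - 1} = 2"
      using g by (auto simp: cyclic_coloring_def)
    ultimately show "{0, 1, 2} \<subseteq> ?c ` ?E" by (metis empty_subsetI image_eqI insert_subset)
  qed
  then show ?thesis by (simp add: exact_coloring_def)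
qed

lemma triangle_coloring_no_mono_path:
  assumes n: "n \<ge> 4" and m: "m \<le> n - 1 + (n - 1) div 2"
  shows "\<not> has_mono_copy (path_graph n) (complete_graph m) (cyclic_coloring (triangle_classes n))"
proof
  let ?c = "cyclic_coloring (triangle_classes n)"
  assume "has_mono_copy (path_graph n) (complete_graph m) ?c"
  then obtain col xs where xs: "path_in {..<m} (color_rel ?c col) xs" "length xs = n"
    by (auto simp: has_mono_copy_path_iff)
  define W where "W = {v \<in> {..<m}. triangle_classes n v \<in> cyclic_classes col}"
  have "u \<in> W \<and> v \<in> W" if "?c {u, v} = col" "u \<in> {..<m}" "v \<in> {..<m}" for u v
    using that cyclic_coloring_in_class[of "triangle_classes n" u v]
      cyclic_coloring_in_class[of "triangle_classes n" v u]
      triangle_classes_le_2[of n] by (simp add: W_def insert_commute)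
  then have "length xs \<le> card W"
    by (intro path_in_length_le_class[OF xs(1)]) (use xs n in \<open>auto simp: W_def\<close>)
  moreover have "card W < n"
  proof -
    have d: "n div 2 + (n - 1) div 2 = n - 1" "(n - 1) div 2 \<le> n div 2" using n by linarith+
    consider "col = 0" | "col = 1" | "col \<noteq> 0" "col \<noteq> 1" by blast
    then show ?thesis
    proof cases
      case 1
      then have "W \<subseteq> {..<n - 1}" by (auto simp: W_def triangle_classes_def cyclic_classes_def split: if_splits)
      then have "card W \<le> card {..<n - 1}" by (intro card_mono) auto
      then show ?thesis using n by simp
    next
      case 2
      then have "W \<subseteq> {n div 2..<m}" by (auto simp: W_def triangle_classes_def cyclic_classes_def split: if_splits)
      then have "card W \<le> card {n div 2..<m}" by (intro card_mono) auto
      moreover have "m < n + n div 2" using n m d by linarith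
      ultimately show ?thesis using n by simp
    next
      case 3
      then have "W \<subseteq> {..<n div 2} \<union> {n - 1..<m}"
        by (auto simp: W_def triangle_classes_def cyclic_classes_def split: if_splits)
      then have "card W \<le> card ({..<n div 2} \<union> {n - 1..<m})" by (intro card_mono) auto
      also have "\<dots> \<le> card {..<n div 2} + card {n - 1..<m}" by (rule card_Un_le)
      finally have "card W \<le> n div 2 + card {n - 1..<m}" by simp
      moreover have "card {n - 1..<m} \<le> (n - 1) div 2" using m by simp
      ultimately show ?thesis using n d by linarith
    qed
  qed
  ultimately show False using xs by simp
qed

section \<open>The values of the Gallai-Ramsey numbers\<close>

text \<open>A bound speaks of all larger orders too, so a single colouring on \<open>N - 1\<close>
  vertices refutes every smaller integer, negative ones included.\<close>

lemma gallai_ramsey_numberI: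
  fixes N :: nat
  assumes bound: "\<And>m c. N \<le> m \<Longrightarrow> exact_coloring k (complete_graph m) c \<Longrightarrow>
      \<not> has_rainbow_copy G (complete_graph m) c \<Longrightarrow> has_mono_copy H (complete_graph m) c"
    and sharp: "exact_coloring k (complete_graph (N - 1)) c"
      "\<not> has_rainbow_copy G (complete_graph (N - 1)) c"
      "\<not> has_mono_copy H (complete_graph (N - 1)) c" "N \<ge> 1"
  shows "gallai_ramsey_number k G H (int N)"
  unfolding gallai_ramsey_number_def
proof (rule disjI1, intro conjI allI impI)
  show "gr_bound k G H (int N)" unfolding gr_bound_def using bound by auto
  fix N' assume N': "gr_bound k G H N'"
  show "int N \<le> N'"
  proof (rule ccontr)
    assume "\<not> int N \<le> N'"
    then have "N' \<le> int (N - 1)" using sharp(4) by linarith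
    then show False using N' sharp unfolding gr_bound_def by blast
  qed
qed

text \<open>This form of the value covers both parities; it is the least \<open>m\<close> with
  \<open>3 * n \<le> 2 * m + 2\<close>.\<close>

lemma gallai_ramsey_3:
  assumes "n \<ge> 4"
  shows "gallai_ramsey_number 3 (star_graph 3) (path_graph n) (int (n + (n - 1) div 2))"
proof (rule gallai_ramsey_numberI)
  show "has_mono_copy (path_graph n) (complete_graph m) c"
    if "n + (n - 1) div 2 \<le> m" "exact_coloring 3 (complete_graph m) c"
      "\<not> has_rainbow_copy (star_graph 3) (complete_graph m) c" for m c
  proof -
    interpret local_2_coloring m c 3 using that by unfold_locales
    show ?thesis by (rule mono_path_3) (use that assms in auto)
  qed
  show "exact_coloring 3 (complete_graph (n + (n - 1) div 2 - 1)) (cyclic_coloring (triangle_classes n))"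
    by (rule triangle_coloring_exact) (use assms in auto)
  show "\<not> has_mono_copy (path_graph n) (complete_graph (n + (n - 1) div 2 - 1)) (cyclic_coloring (triangle_classes n))"
    by (rule triangle_coloring_no_mono_path) (use assms in auto)
qed (use assms triangle_coloring_no_star in auto)

lemma gallai_ramsey_ge_4_large:
  assumes k: "k \<ge> 4" and n: "n > 4 * (k - 2) + 1"
  shows "gallai_ramsey_number k (star_graph 3) (path_graph n) (int (n + n div 2 - 1))"
proof (rule gallai_ramsey_numberI)
  show "has_mono_copy (path_graph n) (complete_graph m) c"
    if "n + n div 2 - 1 \<le> m" "exact_coloring k (complete_graph m) c"
      "\<not> has_rainbow_copy (star_graph 3) (complete_graph m) c" for m c
  proof -
    interpret local_2_coloring m c k using that by unfold_locales
    show ?thesis by (rule mono_path_ge_4) (use that k in auto)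
  qed
  \<comment> \<open>The largest \<open>r\<close> with \<open>2 * r + 2 \<le> n\<close>; the
    assumption on \<open>n\<close> makes it at least \<open>2 * (k - 2)\<close>, so all classes
    fit.\<close>
  let ?r = "n div 2 - 1"
  show "exact_coloring k (complete_graph (n + n div 2 - 1 - 1)) (class_coloring (star_classes k ?r))"
    by (rule star_coloring_exact) (use k n in auto)
  show "\<not> has_mono_copy (path_graph n) (complete_graph (n + n div 2 - 1 - 1)) (class_coloring (star_classes k ?r))"
    by (rule star_coloring_no_mono_path) (use k n in auto)
qed (use n class_coloring_no_star in auto)

lemma gallai_ramsey_ge_4_small:
  assumes k: "k \<ge> 4" and n: "n \<le> 4 * (k - 2) + 1" "2 * (k - 1) \<le> n"
  shows "gallai_ramsey_number k (star_graph 3) (path_graph n) (int n)"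
proof -
  have mono: "has_mono_copy (path_graph n) (complete_graph m) c"
    if "n \<le> m" "exact_coloring k (complete_graph m) c"
      "\<not> has_rainbow_copy (star_graph 3) (complete_graph m) c" for m c
  proof -
    interpret local_2_coloring m c k using that by unfold_locales
    show ?thesis by (rule mono_path_ge_4) (use that k n in auto)
  qed
  show ?thesis
  proof (cases "n = 2 * (k - 1)")
    case True
    \<comment> \<open>The degenerate case: a colouring without a rainbow star already has at least
      \<open>2 * (k - 1) = n\<close> vertices, so every integer is a bound and the number is the
      order of the path.\<close>
    have "gr_bound k (star_graph 3) (path_graph n) N'" for N'
      unfolding gr_bound_def
    proof (intro allI impI)
      fix m c assume c: "exact_coloring k (complete_graph m) c"
      have "has_mono_copy (path_graph n) (complete_graph m) c"
        if no_star: "\<not> has_rainbow_copy (star_graph 3) (complete_graph m) c"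
      proof -
        interpret local_2_coloring m c k using c no_star by unfold_locales
        show ?thesis using mono c no_star order_ge_4[OF k] True by simp
      qed
      then show "has_rainbow_copy (star_graph 3) (complete_graph m) c \<or>
            has_mono_copy (path_graph n) (complete_graph m) c" by blast
    qed
    then show ?thesis by (simp add: gallai_ramsey_number_def path_graph_def)
  next
    case False
    show ?thesis
    \<comment> \<open>Now \<open>n - 1 \<ge> 2 * (k - 1)\<close> leaves room for an exact colouring
      without a rainbow star, while \<open>n - 1\<close> vertices are too few for the path.\<close>
    proof (rule gallai_ramsey_numberI[OF mono])
      show "exact_coloring k (complete_graph (n - 1)) (class_coloring (star_classes k (2 * (k - 2))))"
        by (rule star_coloring_exact) (use k n False in auto)
      show "\<not> has_mono_copy (path_graph n) (complete_graph (n - 1)) (class_coloring (star_classes k (2 * (k - 2))))"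
      proof
        assume "has_mono_copy (path_graph n) (complete_graph (n - 1)) (class_coloring (star_classes k (2 * (k - 2))))"
        then obtain R xs where "path_in {..<n - 1} R xs" "length xs = n"
          by (auto simp: has_mono_copy_path_iff)
        then have "n \<le> n - 1" using path_in_length_le[of "{..<n - 1}"] by fastforce
        then show False using n k by simp
      qed
    qed (use n k class_coloring_no_star in auto)
  qed
qed

theorem theorem1p9:
  shows "(\<forall>n k :: nat. k \<ge> 4 \<and> n \<ge> 2 * (k - 1) \<longrightarrow>
            gallai_ramsey_number k (star_graph 3) (path_graph n)
              (if n \<le> 4 * (k - 2) + 1 then int n else \<lceil>(3 * real n - 3) / 2\<rceil>))
       \<and> (\<forall>n :: nat. n \<ge> 4 \<longrightarrow>
            gallai_ramsey_number 3 (star_graph 3) (path_graph n)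
              (if even n then 3 * int n div 2 - 1 else (3 * int n - 1) div 2))"
proof (intro conjI allI impI)
  fix n k :: nat
  assume nk: "k \<ge> 4 \<and> n \<ge> 2 * (k - 1)"
  show "gallai_ramsey_number k (star_graph 3) (path_graph n)
      (if n \<le> 4 * (k - 2) + 1 then int n else \<lceil>(3 * real n - 3) / 2\<rceil>)"
  proof (cases "n \<le> 4 * (k - 2) + 1")
    case True
    then show ?thesis using gallai_ramsey_ge_4_small nk by simp
  next
    case False
    have "\<lceil>(3 * real n - 3) / 2\<rceil> = int (n + n div 2 - 1)"
    proof (cases "even n")
      case True
      then obtain h where "n = 2 * h" by blast
      then show ?thesis using False by (intro ceiling_unique) auto
    next
      case False': False
      then obtain h where "n = 2 * h + 1" by (rule oddE)
      then show ?thesis using False by (intro ceiling_unique) auto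
    qed
    then show ?thesis using gallai_ramsey_ge_4_large[of k n] nk False by simp
  qed
next
  fix n :: nat
  assume n: "n \<ge> 4"
  have "(if even n then 3 * int n div 2 - 1 else (3 * int n - 1) div 2) = int (n + (n - 1) div 2)"
  proof (cases "even n")
    case True
    then obtain h where "n = 2 * h" by blast
    then show ?thesis using n by auto
  next
    case False
    then obtain h where "n = 2 * h + 1" by (rule oddE)
    then show ?thesis using n by auto
  qed
  then show "gallai_ramsey_number 3 (star_graph 3) (path_graph n)
      (if even n then 3 * int n div 2 - 1 else (3 * int n - 1) div 2)"
    using gallai_ramsey_3[OF n] by simp
qed

end
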